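(* Let $T\ge 1$ be an integer and let $\epsilon\ge \sqrt{1/T}$. There exists an online betting algorithm which, at each time $t=1,\ldots,T$, outputs a confidence $f_t\in[-1,1]$ depending only on $b_1,\ldots,b_{t-1}$, such that for every sequence $b_1,\ldots,b_T\in[-1,1]$ its average gain $\overline{\text{gain}}=\frac1T\sum_{t=1}^T f_t b_t$ satisfies $$\overline{\text{gain}}\ \ge\ \max\left\{\frac1T\left|\sum_{j=1}^T b_j\right|-4\epsilon,\ 0\right\}-\frac{e^{-\epsilon^2T+1}}{\sqrt T}.$$ In particular the algorithm has average regret at most $4\epsilon$ against the strategy $S_+$ that always bets $+1$ and the strategy $S_-$ that always bets $-1$, and its loss (negative gain) is at most $e^{-\epsilon^2T+1}/\sqrt T$ per time step on every sequence.
   Context: Bit prediction game: an adversarial sequence $b_1,\ldots,b_T\in[-1,1]$ is revealed one element at a time. Before $b_t$ is revealed the algorithm commits to a confidence $f_t\in[-1,1]$ (betting $|f_t|$ on the sign $\mathrm{sign}(f_t)$); its payoff at time $t$ is $f_tb_t$ and its total gain is $\sum_t f_tb_t$. Betting $f_t\equiv 0$ corresponds to not playing. The average regret against a strategy is the difference of the strategy's average gain and the algorithm's average gain; $S_+$ has gain $\sum_t b_t$ and $S_-$ has gain $-\sum_t b_t$. *)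

theory Defs
  imports Complex_Main
begin

text \<open>
  An online betting strategy maps the list of bits revealed so far to the next confidence.
  At time \<open>t\<close> it is applied to \<open>[b 1, \<dots>, b (t - 1)]\<close>, so the confidence cannot depend on the
  current or future bits. Sequences are indexed from 1; only \<open>b 1, \<dots>, b T\<close> matter.
\<close>

type_synonym strategy = "real list \<Rightarrow> real"

definition bit_sequence :: "nat \<Rightarrow> (nat \<Rightarrow> real) \<Rightarrow> bool" where
  "bit_sequence T b \<longleftrightarrow> (\<forall>t\<in>{1..T}. b t \<in> {-1..1})"

definition history :: "(nat \<Rightarrow> real) \<Rightarrow> nat \<Rightarrow> real list" where
  "history b t = map b [1..<t]"

definition confidence :: "strategy \<Rightarrow> (nat \<Rightarrow> real) \<Rightarrow> nat \<Rightarrow> real" where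
  "confidence A b t = A (history b t)"

definition betting_algorithm :: "nat \<Rightarrow> strategy \<Rightarrow> bool" where
  "betting_algorithm T A \<longleftrightarrow>
     (\<forall>b. bit_sequence T b \<longrightarrow> (\<forall>t\<in>{1..T}. confidence A b t \<in> {-1..1}))"

definition avg_gain :: "nat \<Rightarrow> strategy \<Rightarrow> (nat \<Rightarrow> real) \<Rightarrow> real" where
  "avg_gain T A b = 1 / real T * (\<Sum>t=1..T. confidence A b t * b t)"

definition avg_regret :: "nat \<Rightarrow> strategy \<Rightarrow> strategy \<Rightarrow> (nat \<Rightarrow> real) \<Rightarrow> real" where
  "avg_regret T A S b = avg_gain T S b - avg_gain T A b"

definition avg_loss :: "nat \<Rightarrow> strategy \<Rightarrow> (nat \<Rightarrow> real) \<Rightarrow> real" where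
  "avg_loss T A b = - avg_gain T A b"

definition S_plus :: strategy where
  "S_plus = (\<lambda>_. 1)"

definition S_minus :: strategy where
  "S_minus = (\<lambda>_. -1)"

end

theory Submission
  imports Defs
begin

text \<open>
  For a convex 1-Lipschitz target \<open>\<Phi>\<close>, let \<open>V n x\<close> be the expectation of \<open>\<Phi>\<close> at the endpoint of a
  simple random walk of \<open>n\<close> steps started in \<open>x\<close>. With \<open>n\<close> steps left after the current one and
  partial sum \<open>x\<close>, betting \<open>(V n (x + 1) - V n (x - 1)) / 2\<close> gains at least the increase of the
  value, so the total gain is at least \<open>\<Phi> (b 1 + \<dots> + b T) - V T 0\<close>. The target
  \<open>max (\<bar>x\<bar> - 4\<epsilon>T) (-c)\<close> with \<open>c = sqrt T * exp (1 - \<epsilon>\<^sup>2 T)\<close> gives all the bounds at once as soon as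
  \<open>V T 0 \<le> 0\<close>, which follows by dominating the target by a multiple of \<open>cosh (\<epsilon> x)\<close>,
  an eigenfunction of the averaging step.
\<close>

fun walk_value :: "(real \<Rightarrow> real) \<Rightarrow> nat \<Rightarrow> real \<Rightarrow> real" where
  "walk_value \<Phi> 0 x = \<Phi> x"
| "walk_value \<Phi> (Suc n) x = (walk_value \<Phi> n (x + 1) + walk_value \<Phi> n (x - 1)) / 2"

definition walk_bet :: "(real \<Rightarrow> real) \<Rightarrow> nat \<Rightarrow> real \<Rightarrow> real" where
  "walk_bet \<Phi> n x = (walk_value \<Phi> n (x + 1) - walk_value \<Phi> n (x - 1)) / 2"

text \<open>At time \<open>t\<close> the history has \<open>t - 1\<close> entries, so the index
  \<open>T - Suc (length h)\<close> is \<open>T - t\<close>, the number of rounds after the current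
  one.\<close>

definition walk_strategy :: "(real \<Rightarrow> real) \<Rightarrow> nat \<Rightarrow> strategy" where
  "walk_strategy \<Phi> T h = walk_bet \<Phi> (T - Suc (length h)) (sum_list h)"

lemma walk_value_mono:
  assumes "\<And>x. \<Phi> x \<le> \<Psi> x"
  shows "walk_value \<Phi> n x \<le> walk_value \<Psi> n x"
proof (induction n arbitrary: x)
  case (Suc n)
  show ?case using Suc[of "x + 1"] Suc[of "x - 1"] by simp
qed (simp add: assms)

lemma walk_value_cosh:
  "walk_value (\<lambda>x. C * cosh (l * x) - c) n x = C * cosh l ^ n * cosh (l * x) - c"
proof (induction n arbitrary: x)
  case (Suc n)
  show ?case
    by (simp add: Suc cosh_add cosh_diff distrib_left right_diff_distrib)
qed simp

text \<open>A bound on increments over distance two survives averaging of shifted copies, and the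
  bet is half of such an increment.\<close>

lemma abs_walk_bet_le_1:
  assumes "\<And>x. \<bar>\<Phi> (x + 1) - \<Phi> (x - 1)\<bar> \<le> 2"
  shows "\<bar>walk_bet \<Phi> n x\<bar> \<le> 1"
proof -
  have "\<bar>walk_value \<Phi> n (x + 1) - walk_value \<Phi> n (x - 1)\<bar> \<le> 2" for x
  proof (induction n arbitrary: x)
    case (Suc n)
    show ?case using Suc[of "x + 1"] Suc[of "x - 1"] by (simp add: abs_le_iff field_simps)
  qed (simp add: assms)
  from this[of x] show ?thesis by (simp add: walk_bet_def abs_le_iff)
qed

text \<open>The chord inequality over [x - 1, x + 1] survives averaging. The chord has midpoint
  value \<open>walk_value \<Phi> (Suc n) x\<close> and slope \<open>walk_bet \<Phi> n x\<close>,
  which gives the right-hand side.\<close>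

lemma walk_value_step:
  assumes convex: "\<And>x. \<Phi> (x + b) \<le> (1 + b) / 2 * \<Phi> (x + 1) + (1 - b) / 2 * \<Phi> (x - 1)"
  shows "walk_value \<Phi> n (x + b) \<le> walk_value \<Phi> (Suc n) x + walk_bet \<Phi> n x * b"
proof -
  have "walk_value \<Phi> n (x + b)
      \<le> (1 + b) / 2 * walk_value \<Phi> n (x + 1) + (1 - b) / 2 * walk_value \<Phi> n (x - 1)" for x
  proof (induction n arbitrary: x)
    case (Suc n)
    show ?case using Suc[of "x + 1"] Suc[of "x - 1"] by (simp add: field_simps)
  qed (use convex in simp)
  from this[of x] show ?thesis by (simp add: walk_bet_def field_simps)
qed

lemma confidence_walk_strategy:
  assumes "t \<ge> 1"
  shows "confidence (walk_strategy \<Phi> T) b t = walk_bet \<Phi> (T - t) (\<Sum>j=1..<t. b j)"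
  using assms
  by (simp add: confidence_def walk_strategy_def history_def interv_sum_list_conv_sum_set_nat)

text \<open>Telescoping of the one-step inequality: no round raises the value by more than its
  gain.\<close>

lemma walk_strategy_gain:
  assumes convex: "\<And>b x. \<bar>b\<bar> \<le> 1 \<Longrightarrow>
      \<Phi> (x + b) \<le> (1 + b) / 2 * \<Phi> (x + 1) + (1 - b) / 2 * \<Phi> (x - 1)"
    and b: "bit_sequence T b"
  shows "\<Phi> (\<Sum>j=1..T. b j) - walk_value \<Phi> T 0
      \<le> (\<Sum>t=1..T. confidence (walk_strategy \<Phi> T) b t * b t)"
proof -
  have "walk_value \<Phi> (T - n) (\<Sum>j=1..n. b j) - walk_value \<Phi> T 0
      \<le> (\<Sum>t=1..n. confidence (walk_strategy \<Phi> T) b t * b t)" if "n \<le> T" for n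
    using that
  proof (induction n)
    case (Suc n)
    let ?x = "\<Sum>j=1..n. b j"
    have "\<bar>b (Suc n)\<bar> \<le> 1"
      using b Suc.prems by (auto simp: bit_sequence_def abs_le_iff)
    then have "walk_value \<Phi> (T - Suc n) (?x + b (Suc n))
        \<le> walk_value \<Phi> (Suc (T - Suc n)) ?x + walk_bet \<Phi> (T - Suc n) ?x * b (Suc n)"
      by (intro walk_value_step convex)
    \<comment> \<open>The truncated subtraction needs \<open>Suc n \<le> T\<close>; the value before
      this round is then the one in the induction hypothesis.\<close>
    moreover have "Suc (T - Suc n) = T - n"
      using Suc.prems by simp
    ultimately show ?case
      using Suc
      by (simp add: confidence_walk_strategy atLeastLessThanSuc_atLeastAtMost
               del: walk_value.simps)
  qed simp
  from this[of T] show ?thesis by simp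
qed

lemma cosh_le_exp_square: "cosh x \<le> exp (x\<^sup>2)" for x :: real
proof -
  have *: "cosh x \<le> exp (x\<^sup>2)" if x: "x \<ge> 0" for x :: real
  proof (cases "x \<le> 1")
    case True
    have pos: "exp x \<le> 1 + x + x\<^sup>2"
      using exp_bound x True by blast
    \<comment> \<open>The product is 1 + x^3.\<close>
    have "1 \<le> (1 - x + x\<^sup>2) * (1 + x)"
      using x by (simp add: power2_eq_square algebra_simps)
    also have "\<dots> \<le> (1 - x + x\<^sup>2) * exp x"
      using x True by (intro mult_left_mono exp_ge_add_one_self) auto
    finally have "exp (- x) \<le> 1 - x + x\<^sup>2"
      by (simp add: exp_minus field_simps)
    with pos have "cosh x \<le> 1 + x\<^sup>2"
      by (simp add: cosh_field_def)
    then show ?thesis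
      using exp_ge_add_one_self[of "x\<^sup>2"] by linarith
  next
    case False
    have "cosh x \<le> exp x"
      using x by (simp add: cosh_field_def)
    also have "\<dots> \<le> exp (x\<^sup>2)"
      using False by (simp add: power2_eq_square)
    finally show ?thesis .
  qed
  show ?thesis
    using *[of x] *[of "- x"] by (cases "x \<ge> 0") auto
qed

text \<open>The target is a maximum of three affine functions. Each coincides with its own chord,
  whose endpoints lie below those of the target's chord.\<close>

lemma max_convex_step:
  fixes b :: real
  assumes "\<bar>b\<bar> \<le> 1"
  shows "max (\<bar>x + b\<bar> - k) (- c) \<le>
      (1 + b) / 2 * max (\<bar>x + 1\<bar> - k) (- c) + (1 - b) / 2 * max (\<bar>x - 1\<bar> - k) (- c)"
    (is "_ \<le> (1 + b) / 2 * ?u + (1 - b) / 2 * ?v")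
proof -
  have mix: "r \<le> (1 + b) / 2 * ?u + (1 - b) / 2 * ?v"
    if "p \<le> ?u" "q \<le> ?v" "r = (1 + b) / 2 * p + (1 - b) / 2 * q" for p q r
    unfolding that(3) using assms that(1,2) by (intro add_mono mult_left_mono) auto
  have "x + b - k \<le> (1 + b) / 2 * ?u + (1 - b) / 2 * ?v"
    by (rule mix[of "x + 1 - k" "x - 1 - k"]) (linarith, linarith, simp add: field_simps)
  moreover have "- x - b - k \<le> (1 + b) / 2 * ?u + (1 - b) / 2 * ?v"
    by (rule mix[of "- x - 1 - k" "1 - x - k"]) (linarith, linarith, simp add: field_simps)
  moreover have "- c \<le> (1 + b) / 2 * ?u + (1 - b) / 2 * ?v"
    by (rule mix[of "- c" "- c"]) (linarith, linarith, simp add: field_simps)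
  ultimately show ?thesis by (intro max.boundedI) linarith+
qed

text \<open>Adding \<open>c\<close> turns the target into the positive part of \<open>?y\<close>;
  then z \<le> exp z at z = \<open>l * ?y\<close> bounds it by an exponential, and
  \<open>2 * cosh (l * x)\<close> dominates \<open>exp (l * \<bar>x\<bar>)\<close>.\<close>

lemma max_le_cosh:
  fixes l :: real
  assumes "l > 0"
  shows "max (\<bar>x\<bar> - k) (- c) \<le> 2 * exp (- (l * (k - c))) / l * cosh (l * x) - c"
proof -
  let ?y = "\<bar>x\<bar> - (k - c)"
  have "l * ?y \<le> exp (l * ?y)"
    using exp_ge_add_one_self[of "l * ?y"] by linarith
  then have "max ?y 0 \<le> exp (l * ?y) / l"
    using assms by (auto simp: field_simps)
  also have "exp (l * ?y) = exp (- (l * (k - c))) * exp (l * \<bar>x\<bar>)"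
    by (simp add: exp_add[symmetric] algebra_simps)
  also have "exp (l * \<bar>x\<bar>) \<le> 2 * cosh (l * x)"
    by (cases "x \<ge> 0") (auto simp: cosh_field_def)
  finally have "max ?y 0 \<le> exp (- (l * (k - c))) * (2 * cosh (l * x)) / l"
    using assms by (simp add: divide_right_mono)
  moreover have "max (\<bar>x\<bar> - k) (- c) = max ?y 0 - c"
    by linarith
  ultimately show ?thesis by (simp add: mult.commute mult.left_commute)
qed

lemma walk_value_target_nonpos:
  fixes T :: nat and \<epsilon> :: real
  assumes T: "T \<ge> 1" and eps: "\<epsilon> \<ge> sqrt (1 / real T)"
  defines "c \<equiv> sqrt (real T) * exp (- (\<epsilon>\<^sup>2 * real T) + 1)"
  shows "walk_value (\<lambda>x. max (\<bar>x\<bar> - 4 * \<epsilon> * real T) (- c)) T 0 \<le> 0"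
proof -
  have sqrtT: "sqrt (real T) > 0" using T by simp
  have "1 \<le> \<epsilon> * sqrt (real T)"
    using eps sqrtT by (simp add: real_sqrt_divide field_simps)
  then have eps_pos: "\<epsilon> > 0" and inv: "1 / \<epsilon> \<le> sqrt (real T)"
    using sqrtT zero_less_mult_pos2[of \<epsilon> "sqrt (real T)"] by (auto simp: field_simps)
  have "1 \<le> (\<epsilon> * sqrt (real T))\<^sup>2"
    using \<open>1 \<le> \<epsilon> * sqrt (real T)\<close> by simp
  then have "1 \<le> \<epsilon>\<^sup>2 * real T"
    by (simp add: power_mult_distrib)
  \<comment> \<open>The floor \<open>c\<close> uses up at most one of the four units
    \<open>\<epsilon> * real T\<close> in the threshold, so three remain in the exponent of
    \<open>C\<close>.\<close>
  then have "c \<le> sqrt (real T) * 1"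
    unfolding c_def by (intro mult_left_mono) auto
  also have "\<dots> \<le> sqrt (real T) * (\<epsilon> * sqrt (real T))"
    using \<open>1 \<le> \<epsilon> * sqrt (real T)\<close> by (intro mult_left_mono) auto
  finally have c_le: "c \<le> \<epsilon> * real T"
    by (simp add: mult.left_commute)
  define k where "k = 4 * \<epsilon> * real T"
  define C where "C = 2 * exp (- (\<epsilon> * (k - c))) / \<epsilon>"
  have "\<epsilon> * (k - c) \<ge> \<epsilon> * (3 * \<epsilon> * real T)"
    using c_le eps_pos by (intro mult_left_mono) (auto simp: k_def)
  then have C_le: "C \<le> 2 * exp (- 3 * (\<epsilon>\<^sup>2 * real T)) / \<epsilon>"
    unfolding C_def using eps_pos
    by (intro divide_right_mono mult_left_mono) (auto simp: power2_eq_square algebra_simps)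
  have "cosh \<epsilon> ^ T \<le> exp (\<epsilon>\<^sup>2) ^ T"
    by (intro power_mono cosh_le_exp_square) simp
  then have cosh_le: "cosh \<epsilon> ^ T \<le> exp (\<epsilon>\<^sup>2 * real T)"
    by (simp add: exp_of_nat_mult[symmetric] mult.commute)
  have "walk_value (\<lambda>x. max (\<bar>x\<bar> - k) (- c)) T 0
      \<le> walk_value (\<lambda>x. C * cosh (\<epsilon> * x) - c) T 0"
    unfolding C_def by (intro walk_value_mono max_le_cosh eps_pos)
  also have "\<dots> = C * cosh \<epsilon> ^ T - c"
    by (simp add: walk_value_cosh)
  \<comment> \<open>With rate \<open>\<epsilon>\<close>, the growth of \<open>cosh\<close> costs one
    of the three units \<open>\<epsilon>\<^sup>2 * real T\<close> of decay. Of the two left, one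
    matches the decay in \<open>c\<close>; the constant 2 is absorbed by
    \<open>exp 1\<close>.\<close>
  also have "C * cosh \<epsilon> ^ T
      \<le> 2 * exp (- 3 * (\<epsilon>\<^sup>2 * real T)) / \<epsilon> * exp (\<epsilon>\<^sup>2 * real T)"
    using C_le cosh_le eps_pos by (intro mult_mono) auto
  also have "\<dots> = 1 / \<epsilon> * (2 * exp (- 2 * (\<epsilon>\<^sup>2 * real T)))"
    by (simp add: exp_add[symmetric])
  also have "\<dots> \<le> sqrt (real T) * (exp 1 * exp (- (\<epsilon>\<^sup>2 * real T)))"
    using exp_ge_add_one_self[of 1] inv by (intro mult_mono) auto
  also have "\<dots> = c"
    by (simp add: c_def exp_add[symmetric])
  finally show ?thesis by (simp add: k_def)
qed

theorem theorem1:
  fixes T :: nat and \<epsilon> :: real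
  assumes "T \<ge> 1" and "\<epsilon> \<ge> sqrt (1 / real T)"
  shows "\<exists>A. betting_algorithm T A \<and>
    (\<forall>b. bit_sequence T b \<longrightarrow>
       avg_gain T A b \<ge> max (1 / real T * \<bar>\<Sum>j=1..T. b j\<bar> - 4 * \<epsilon>) 0
                          - exp (- (\<epsilon>\<^sup>2 * real T) + 1) / sqrt (real T) \<and>
       avg_regret T A S_plus b \<le> 4 * \<epsilon> \<and>
       avg_regret T A S_minus b \<le> 4 * \<epsilon> \<and>
       avg_loss T A b \<le> exp (- (\<epsilon>\<^sup>2 * real T) + 1) / sqrt (real T))"
proof -
  define c where "c = sqrt (real T) * exp (- (\<epsilon>\<^sup>2 * real T) + 1)"
  \<comment> \<open>The floor \<open>- c\<close> is \<open>T\<close> times the allowed average loss.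
    The other branch carries no \<open>c\<close>, so the regret bounds are exactly
    \<open>4 * \<epsilon>\<close>, without an added loss term.\<close>
  define \<Phi> where "\<Phi> x = max (\<bar>x\<bar> - 4 * \<epsilon> * real T) (- c)" for x
  define A where "A = walk_strategy \<Phi> T"
  have T: "real T > 0" using assms by simp
  have c_avg: "c / real T = exp (- (\<epsilon>\<^sup>2 * real T) + 1) / sqrt (real T)"
    using T by (simp add: c_def field_simps flip: power2_eq_square)
  have "\<bar>\<Phi> (x + 1) - \<Phi> (x - 1)\<bar> \<le> 2" for x
    unfolding \<Phi>_def by linarith
  then have bet: "betting_algorithm T A"
    using abs_walk_bet_le_1[of \<Phi>]
    by (auto simp: betting_algorithm_def A_def confidence_walk_strategy abs_le_iff minus_le_iff)
  have bounds: "avg_gain T A b \<ge> 1 / real T * \<bar>\<Sum>j=1..T. b j\<bar> - 4 * \<epsilon>"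
    "avg_gain T A b \<ge> - (c / real T)" if b: "bit_sequence T b" for b
  proof -
    have "\<Phi> (\<Sum>j=1..T. b j) - walk_value \<Phi> T 0 \<le> (\<Sum>t=1..T. confidence A b t * b t)"
      unfolding A_def \<Phi>_def using b by (intro walk_strategy_gain max_convex_step)
    moreover have "walk_value \<Phi> T 0 \<le> 0"
      using walk_value_target_nonpos[OF assms] unfolding \<Phi>_def c_def .
    ultimately have "\<Phi> (\<Sum>j=1..T. b j) \<le> real T * avg_gain T A b"
      using T by (simp add: avg_gain_def)
    then show "avg_gain T A b \<ge> 1 / real T * \<bar>\<Sum>j=1..T. b j\<bar> - 4 * \<epsilon>"
      "avg_gain T A b \<ge> - (c / real T)"
      using T by (simp_all add: \<Phi>_def field_simps)
  qed
  have S: "avg_gain T S_plus b = 1 / real T * (\<Sum>j=1..T. b j)"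
    "avg_gain T S_minus b = 1 / real T * - (\<Sum>j=1..T. b j)" for b
    by (simp_all add: avg_gain_def confidence_def S_plus_def S_minus_def sum_negf)
  have le_abs: "1 / real T * s \<le> 1 / real T * \<bar>s\<bar>" "1 / real T * - s \<le> 1 / real T * \<bar>s\<bar>" for s
    using T by (intro mult_left_mono; simp)+
  have "c / real T \<ge> 0"
    by (simp add: c_def)
  show ?thesis
    unfolding c_avg[symmetric]
  proof (intro exI[of _ A] conjI allI impI bet)
    fix b assume b: "bit_sequence T b"
    note gain = bounds[OF b]
    show "max (1 / real T * \<bar>\<Sum>j=1..T. b j\<bar> - 4 * \<epsilon>) 0 - c / real T \<le> avg_gain T A b"
      using gain \<open>c / real T \<ge> 0\<close> by linarith
    show "avg_regret T A S_plus b \<le> 4 * \<epsilon>" "avg_regret T A S_minus b \<le> 4 * \<epsilon>"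
      using gain(1) le_abs[of "\<Sum>j=1..T. b j"] unfolding avg_regret_def S by linarith+
    show "avg_loss T A b \<le> c / real T"
      using gain(2) by (simp add: avg_loss_def)
  qed
qed

end
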